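(* Let $d \geq 1$ be an integer, let $\mu > 0$, and let $N$ be the $d$-dimensional Poisson point process with intensity $\mu$ on $\mathbb{R}^d$. Let $B \subset \mathbb{R}^d$ be a bounded Borel set with $\lambda(B) > 0$, where $\lambda$ is the Lebesgue measure on $\mathbb{R}^d$, and let $n \geq 0$ be an integer. Let $U_1, U_2, \ldots, U_n$ be independent random variables, each $\mathrm{Uniform}(B)$, and, on the event $\{N(B) = n\}$, let $P_1, P_2, \ldots, P_n \in \mathbb{R}^d$ be the Poisson points of $N$ in $B$. Then, given that $N(B) = n$, $\{U_1, \ldots, U_n\} = \{P_1, \ldots, P_n\}$ in distribution, in the sense that, for all Borel subsets $A \subset B$ and all $k = 0, 1, \ldots, n$, $$P\big(\mathrm{card}(A \cap \{U_1, U_2, \ldots, U_n\}) = k\big) = P\big(\mathrm{card}(A \cap \{P_1, P_2, \ldots, P_n\}) = k \,\big|\, N(B) = n\big).$$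
   Context: Let $\mathscr{B}(\mathbb{R}^d)$ be the Borel $\sigma$-algebra of $\mathbb{R}^d$ and $\lambda$ the Lebesgue measure. The Poisson point process with intensity $\mu$ on $\mathbb{R}^d$ is a counting process $N = \{N(B) : B \in \mathscr{B}(\mathbb{R}^d) \text{ bounded}\}$, where $N(B)$ is the number of entities, called Poisson points, of a random collection of points of $\mathbb{R}^d$ that lie in the Borel set $B$ (that is, $N(B) = \mathrm{card}(\Pi \cap B)$, where $\Pi \subset \mathbb{R}^d$ is the random set of Poisson points), such that: (i) for all pairwise disjoint (bounded) $B_1, B_2, \ldots, B_k \in \mathscr{B}(\mathbb{R}^d)$, the random variables $N(B_1), N(B_2), \ldots, N(B_k)$ are independent; (ii) for all bounded $B \in \mathscr{B}(\mathbb{R}^d)$, $N(B)$ has the Poisson distribution with parameter $\mu \lambda(B)$. On the event $\{N(B) = n\}$, the Poisson points in $B$ are the $n$ elements $P_1, \ldots, P_n$ of $\Pi \cap B$, listed in any order. The uniform random variable $\mathrm{Uniform}(B)$ on a bounded Borel set $B$ is the continuous random variable with values in $\mathbb{R}^d$ and density function $\phi = \mathbf{1}_B / \lambda(B)$ with respect to $\lambda$. The notation $\mathrm{card}$ denotes the cardinality of a set. *)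

theory Defs
  imports "HOL-Probability.Probability"
begin

definition num_points :: "('w \<Rightarrow> 'a set) \<Rightarrow> 'a set \<Rightarrow> 'w \<Rightarrow> nat" where
  "num_points \<Phi> B \<omega> = card (\<Phi> \<omega> \<inter> B)"

(* The mass function is spelled out instead of using poisson_pmf, because the rate may be 0
   (the point mass at 0), which poisson_pmf does not cover. *)
definition poisson_distributed :: "'w measure \<Rightarrow> ('w \<Rightarrow> nat) \<Rightarrow> real \<Rightarrow> bool" where
  "poisson_distributed M X r \<longleftrightarrow>
     distributed M (count_space UNIV) X (\<lambda>k. ennreal (r ^ k / fact k * exp (- r)))"

(* Here \<Phi> \<omega> is the set of Poisson points. The assumption locally_finite is there because card
   is 0 on infinite sets: that N(B) is Poisson distributed as a genuine number of points
   includes that this number is almost surely finite. *)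
locale poisson_point_process = prob_space M
  for M :: "'w measure" and \<mu> :: real and \<Phi> :: "'w \<Rightarrow> (real ^ 'd) set" +
  assumes locally_finite:
      "\<And>B. B \<in> sets borel \<Longrightarrow> bounded B \<Longrightarrow> AE \<omega> in M. finite (\<Phi> \<omega> \<inter> B)"
    and indep_num_points:
      "\<And>(k::nat) B. (\<And>i. i \<in> {1..k} \<Longrightarrow> B i \<in> sets borel \<and> bounded (B i)) \<Longrightarrow>
         disjoint_family_on B {1..k} \<Longrightarrow>
         indep_vars (\<lambda>_. count_space UNIV) (\<lambda>i. num_points \<Phi> (B i)) {1..k}"
    and poisson_num_points:
      "\<And>B. B \<in> sets borel \<Longrightarrow> bounded B \<Longrightarrow>
         poisson_distributed M (num_points \<Phi> B) (\<mu> * measure lborel B)"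

definition uniform_on :: "'w measure \<Rightarrow> ('w \<Rightarrow> real ^ 'd) \<Rightarrow> (real ^ 'd) set \<Rightarrow> bool" where
  "uniform_on M X B \<longleftrightarrow> distributed M lborel X (\<lambda>x. indicator B x / emeasure lborel B)"

end

(* Both sides equal the binomial probability (n choose k) p^k (1 - p)^(n - k) with
   p = lambda(A) / lambda(B). For the uniform variables this is Bernoulli trials, once one knows that
   the U_i are almost surely distinct, so that the cardinality counts the indices with U_i in A.
   For the Poisson points, N(A) and N(B - A) are independent Poisson variables with sum N(B). *)

theory Submission
  imports Defs
begin

section \<open>Pairwise independence and almost sure distinctness\<close>

text \<open>Restriction to the disjoint index blocks \<open>{i}\<close> and \<open>{j}\<close> keeps
  independence, and evaluation at the only coordinate recovers the two variables.\<close>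

lemma (in prob_space) indep_var_of_indep_vars:
  assumes "indep_vars N X I" "i \<in> I" "j \<in> I" "i \<noteq> j"
  shows "indep_var (N i) (X i) (N j) (X j)"
proof -
  have "indep_var (PiM {i} N) (\<lambda>\<omega>. restrict (\<lambda>l. X l \<omega>) {i}) (PiM {j} N) (\<lambda>\<omega>. restrict (\<lambda>l. X l \<omega>) {j})"
    using assms by (intro indep_var_restrict[OF assms(1)]) auto
  from indep_var_compose[OF this, of "\<lambda>f. f i" "N i" "\<lambda>f. f j" "N j"] show ?thesis
    by (simp add: comp_def)
qed

text \<open>A law with a Lebesgue density has no atoms, and independence makes the joint law a
  product; by Fubini the diagonal is then a null set.\<close>

lemma (in prob_space) AE_neq_of_indep_var:
  fixes X Y :: "'a \<Rightarrow> 'b::euclidean_space"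
  assumes ind: "indep_var borel X borel Y" and Y: "distributed M lborel Y f"
  shows "AE \<omega> in M. X \<omega> \<noteq> Y \<omega>"
proof -
  note [measurable] = indep_var_rv1[OF ind] indep_var_rv2[OF ind]
  interpret DY: prob_space "distr M borel Y" by (rule prob_space_distr) simp
  interpret DX: prob_space "distr M borel X" by (rule prob_space_distr) simp
  interpret XY: pair_sigma_finite "distr M borel X" "distr M borel Y" ..
  have sing: "emeasure (distr M borel Y) {x} = 0" for x
  proof -
    have "emeasure (distr M borel Y) {x} = emeasure M (Y -` {x} \<inter> space M)"
      by (subst emeasure_distr) auto
    also have "\<dots> = (\<integral>\<^sup>+y. f y * indicator {x} y \<partial>lborel)"
      by (rule distributed_emeasure[OF Y]) simp
    also have "\<dots> = 0"
    proof -
      have "AE y in lborel. y \<noteq> x" by (rule AE_lborel_singleton)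
      hence "AE y in lborel. f y * indicator {x} y = 0" by eventually_elim auto
      thus ?thesis
        using distributed_borel_measurable[OF Y] by (subst nn_integral_0_iff_AE) auto
    qed
    finally show ?thesis .
  qed
  have "AE z in distr M borel X \<Otimes>\<^sub>M distr M borel Y. fst z \<noteq> snd z"
  proof (rule XY.AE_pair_measure)
    show "{z \<in> space (distr M borel X \<Otimes>\<^sub>M distr M borel Y). fst z \<noteq> snd z}
        \<in> sets (distr M borel X \<Otimes>\<^sub>M distr M borel Y)"
      by measurable
    \<comment> \<open>For fixed \<open>x\<close> the exceptional set is the single point
      \<open>x\<close>, which is null by \<open>sing\<close>.\<close>
    have "AE y in distr M borel Y. y \<noteq> x" for x
      by (rule AE_I[where N = "{x}"]) (auto simp: sing)
    hence "AE y in distr M borel Y. x \<noteq> y" for x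
      by (metis (mono_tags, lifting) eventually_mono)
    thus "AE x in distr M borel X. AE y in distr M borel Y. fst (x, y) \<noteq> snd (x, y)"
      by simp
  qed
  \<comment> \<open>Independence identifies the product of the two laws with the law of the pair, so
    the statement pulls back to \<open>M\<close>.\<close>
  hence "AE z in distr M (borel \<Otimes>\<^sub>M borel) (\<lambda>\<omega>. (X \<omega>, Y \<omega>)). fst z \<noteq> snd z"
    using ind unfolding indep_var_distribution_eq by metis
  thus ?thesis
    by (subst (asm) AE_distr_iff) auto
qed

section \<open>Bernoulli trials\<close>

text \<open>The event splits according to the exact set \<open>J\<close> of successful indices:
  independence gives every \<open>J\<close> of size \<open>k\<close> the same probability, and there
  are \<open>card I choose k\<close> such sets.\<close>

lemma (in prob_space) prob_card_indep_binomial: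
  fixes X :: "'i \<Rightarrow> 'a \<Rightarrow> 'b"
  assumes ind: "indep_vars (\<lambda>_. N) X I" and I: "finite I" and A[measurable]: "A \<in> sets N"
    and p: "\<And>i. i \<in> I \<Longrightarrow> prob {\<omega> \<in> space M. X i \<omega> \<in> A} = p"
  shows "prob {\<omega> \<in> space M. card {i \<in> I. X i \<omega> \<in> A} = k}
       = real (card I choose k) * p ^ k * (1 - p) ^ (card I - k)"
\<comment> \<open>Below, \<open>E J\<close> becomes an intersection over \<open>I\<close>; for empty
  \<open>I\<close> that would be \<open>UNIV\<close> rather than \<open>space M\<close>.\<close>
proof (cases "I = {}")
  case True
  then show ?thesis by (cases k) (auto simp: prob_space)
next
  case False
  have rv[measurable]: "X i \<in> measurable M N" if "i \<in> I" for i
    using ind that unfolding indep_vars_def by auto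
  define E where "E J = {\<omega> \<in> space M. {i \<in> I. X i \<omega> \<in> A} = J}" for J
  \<comment> \<open>For \<open>i\<close> in \<open>I\<close>, \<open>C J i\<close> is the set that
    \<open>X i\<close> has to hit for the successes to be exactly \<open>J\<close>.\<close>
  define C where "C J i = (if i \<in> J then A else space N - A)" for J and i :: 'i
  have C: "C J i \<in> sets N" for J i by (auto simp: C_def)
  have q: "prob (X i -` C J i \<inter> space M) = (if i \<in> J then p else 1 - p)" if i: "i \<in> I" for i J
  proof (cases "i \<in> J")
    case True
    then show ?thesis using p[OF i] by (auto simp: C_def vimage_def Int_def conj_commute)
  next
    case False
    have "X i -` C J i \<inter> space M = space M - {\<omega> \<in> space M. X i \<omega> \<in> A}"
      using False measurable_space[OF rv[OF i]] by (auto simp: C_def)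
    then show ?thesis using False p[OF i] i by (simp add: prob_compl)
  qed
  have E_eq: "E J = (\<Inter>i\<in>I. X i -` C J i \<inter> space M)" if "J \<subseteq> I" for J
    using that False measurable_space[OF rv] by (auto simp: E_def C_def split: if_splits)
  have Em: "E J \<in> events" if "J \<subseteq> I" for J
    unfolding E_eq[OF that] using False I C rv
    by (intro sets.finite_INT) (auto intro: measurable_sets)
  have prob_E: "prob (E J) = p ^ card J * (1 - p) ^ (card I - card J)" if J: "J \<subseteq> I" for J
  proof -
    have "prob (E J) = (\<Prod>i\<in>I. prob (X i -` C J i \<inter> space M))"
      unfolding E_eq[OF J] using indep_varsD[OF ind, of I "C J"] False I C by auto
    also have "\<dots> = (\<Prod>i\<in>I. if i \<in> J then p else 1 - p)"
      using q by (intro prod.cong) auto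
    also have "\<dots> = p ^ card J * (1 - p) ^ card (I - J)"
      using I J by (simp add: prod.If_cases Int_absorb1 Diff_eq)
    finally show ?thesis using I J by (simp add: card_Diff_subset finite_subset)
  qed
  have "{\<omega> \<in> space M. card {i \<in> I. X i \<omega> \<in> A} = k} = (\<Union>J\<in>{J. J \<subseteq> I \<and> card J = k}. E J)"
    by (auto simp: E_def)
  hence "prob {\<omega> \<in> space M. card {i \<in> I. X i \<omega> \<in> A} = k}
       = (\<Sum>J | J \<subseteq> I \<and> card J = k. prob (E J))"
    using I Em by (auto simp: E_def disjoint_family_on_def intro!: finite_measure_finite_Union)
  also have "\<dots> = (\<Sum>J | J \<subseteq> I \<and> card J = k. p ^ k * (1 - p) ^ (card I - k))"
    by (intro sum.cong) (auto simp: prob_E)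
  also have "\<dots> = real (card I choose k) * p ^ k * (1 - p) ^ (card I - k)"
    by (simp add: n_subsets[OF I])
  finally show ?thesis .
qed

text \<open>Almost sure agreement with a measurable count of indices does not yield measurability,
  as \<open>M\<close> need not be complete; so the cardinality itself is written as a finite sum of
  measurable indicators.\<close>

lemma measurable_card_inter_image:
  fixes X :: "nat \<Rightarrow> 'a \<Rightarrow> 'b::{second_countable_topology, t2_space}"
  assumes [measurable]: "\<And>i. i \<in> {1..n} \<Longrightarrow> X i \<in> borel_measurable M" "A \<in> sets borel"
  shows "(\<lambda>\<omega>. card (A \<inter> (\<lambda>i. X i \<omega>) ` {1..n})) \<in> measurable M (count_space UNIV)"
proof -
  \<comment> \<open>count each value at its first index\<close>
  define F where "F \<omega> i \<longleftrightarrow> X i \<omega> \<in> A \<and> (\<forall>j\<in>{1..<i}. X j \<omega> \<noteq> X i \<omega>)" for \<omega> i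
  have "card (A \<inter> (\<lambda>i. X i \<omega>) ` {1..n}) = (\<Sum>i\<in>{1..n}. if F \<omega> i then 1 else 0)" for \<omega>
  proof -
    have "A \<inter> (\<lambda>i. X i \<omega>) ` {1..n} = (\<lambda>i. X i \<omega>) ` {i\<in>{1..n}. F \<omega> i}" (is "?L = ?R")
    proof
      show "?L \<subseteq> ?R"
      proof
        fix x assume x: "x \<in> ?L"
        \<comment> \<open>The bound \<open>1 \<le> i\<close> keeps out the index 0, which lies
          outside \<open>{1..n}\<close> but might also take the value \<open>x\<close>.\<close>
        define m where "m = (LEAST i. 1 \<le> i \<and> X i \<omega> = x)"
        from x obtain i where i: "1 \<le> i \<and> X i \<omega> = x" "i \<le> n" by auto
        have m: "1 \<le> m \<and> X m \<omega> = x" unfolding m_def using i(1) by (rule LeastI)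
        have "m \<le> i" unfolding m_def using i(1) by (rule Least_le)
        moreover have "X j \<omega> \<noteq> x" if "1 \<le> j" "j < m" for j
          using that not_less_Least[of j "\<lambda>i. 1 \<le> i \<and> X i \<omega> = x"] unfolding m_def by auto
        ultimately show "x \<in> ?R" using m x i by (auto simp: F_def intro!: image_eqI[of _ _ m])
      qed
    qed (auto simp: F_def)
    moreover have "inj_on (\<lambda>i. X i \<omega>) {i\<in>{1..n}. F \<omega> i}"
      by (rule linorder_inj_onI') (auto simp: F_def)
    ultimately show ?thesis
      by (simp add: card_image sum.If_cases Int_def)
  qed
  moreover have "(\<lambda>\<omega>. \<Sum>i\<in>{1..n}. if F \<omega> i then 1 else 0 :: nat) \<in> measurable M (count_space UNIV)"
    unfolding F_def by measurable
  ultimately show ?thesis by simp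
qed

section \<open>The uniform sample\<close>

lemma (in prob_space) prob_card_uniform:
  fixes U :: "nat \<Rightarrow> 'a \<Rightarrow> real ^ 'd"
  assumes ind: "indep_vars (\<lambda>_. borel) U {1..n}"
    and unif: "\<And>i. i \<in> {1..n} \<Longrightarrow> uniform_on M (U i) B"
    and B: "B \<in> sets borel" "bounded B" "emeasure lborel B > 0"
    and A: "A \<in> sets borel" "A \<subseteq> B"
  defines "p \<equiv> measure lborel A / measure lborel B"
  shows "prob {\<omega> \<in> space M. card (A \<inter> (\<lambda>i. U i \<omega>) ` {1..n}) = k}
       = real (n choose k) * p ^ k * (1 - p) ^ (n - k)"
proof -
  have rv[measurable]: "U i \<in> borel_measurable M" if "i \<in> {1..n}" for i
    using ind that unfolding indep_vars_def by auto
  note [measurable] = A(1) B(1)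
  have fin: "emeasure lborel B < \<infinity>" "emeasure lborel A < \<infinity>"
    using emeasure_bounded_finite B(2) bounded_subset[OF B(2) A(2)] by auto
  have p: "prob {\<omega> \<in> space M. U i \<omega> \<in> A} = p" if i: "i \<in> {1..n}" for i
  proof -
    have "emeasure M (U i -` A \<inter> space M)
        = (\<integral>\<^sup>+x. indicator B x / emeasure lborel B * indicator A x \<partial>lborel)"
      using unif[OF i] A(1) unfolding uniform_on_def by (intro distributed_emeasure) auto
    \<comment> \<open>Since \<open>A\<close> lies in \<open>B\<close>, the indicator of
      \<open>A\<close> absorbs that of \<open>B\<close>.\<close>
    also have "\<dots> = (\<integral>\<^sup>+x. indicator A x / emeasure lborel B \<partial>lborel)"
      using A(2) by (intro nn_integral_cong) (auto split: split_indicator)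
    also have "\<dots> = emeasure lborel A / emeasure lborel B"
      by (simp add: nn_integral_divide)
    also have "\<dots> = ennreal p"
      using fin B(3) unfolding p_def
      by (simp add: emeasure_eq_ennreal_measure divide_ennreal)
    finally show ?thesis
      by (simp add: measure_def p_def vimage_def Int_def conj_commute)
  qed
  have "AE \<omega> in M. U i \<omega> \<noteq> U j \<omega>" if "i \<in> {1..n}" "j \<in> {1..n}" "i \<noteq> j" for i j
    using AE_neq_of_indep_var[OF indep_var_of_indep_vars[OF ind]] that unif[of j]
    unfolding uniform_on_def by auto
  hence "AE \<omega> in M. \<forall>i\<in>{1..n}. \<forall>j\<in>{1..n}. i \<noteq> j \<longrightarrow> U i \<omega> \<noteq> U j \<omega>"
    by (auto simp: AE_finite_all intro!: AE_finite_allI AE_impI)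
  \<comment> \<open>Where the values are pairwise distinct, indexing is injective, so the points in
    \<open>A\<close> correspond to the successful indices.\<close>
  hence "AE \<omega> in M. card (A \<inter> (\<lambda>i. U i \<omega>) ` {1..n}) = card {i \<in> {1..n}. U i \<omega> \<in> A}"
  proof eventually_elim
    case (elim \<omega>)
    hence "inj_on (\<lambda>i. U i \<omega>) {i \<in> {1..n}. U i \<omega> \<in> A}" unfolding inj_on_def by blast
    moreover have "A \<inter> (\<lambda>i. U i \<omega>) ` {1..n} = (\<lambda>i. U i \<omega>) ` {i \<in> {1..n}. U i \<omega> \<in> A}" by auto
    ultimately show ?case by (simp add: card_image)
  qed
  \<comment> \<open>Passing from almost sure equality to equal probabilities takes both events to be
    measurable.\<close>
  moreover have "{\<omega> \<in> space M. card (A \<inter> (\<lambda>i. U i \<omega>) ` {1..n}) = k} \<in> events"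
  proof -
    have "(\<lambda>\<omega>. card (A \<inter> (\<lambda>i. U i \<omega>) ` {1..n})) \<in> measurable M (count_space UNIV)"
      using rv A(1) by (rule measurable_card_inter_image)
    from measurable_sets[OF this, of "{k}"] show ?thesis
      by (simp add: vimage_def Int_def conj_commute)
  qed
  moreover have "{\<omega> \<in> space M. card {i \<in> {1..n}. U i \<omega> \<in> A} = k} \<in> events"
  proof -
    have "card {i \<in> {1..n}. U i \<omega> \<in> A} = (\<Sum>i\<in>{1..n}. if U i \<omega> \<in> A then 1 else 0)" for \<omega>
      by (simp add: sum.If_cases Int_def)
    then show ?thesis by (simp only:) measurable
  qed
  ultimately have "prob {\<omega> \<in> space M. card (A \<inter> (\<lambda>i. U i \<omega>) ` {1..n}) = k}
      = prob {\<omega> \<in> space M. card {i \<in> {1..n}. U i \<omega> \<in> A} = k}"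
    by (intro finite_measure_eq_AE) auto
  also have "\<dots> = real (n choose k) * p ^ k * (1 - p) ^ (n - k)"
    using prob_card_indep_binomial[OF ind _ A(1) p] by simp
  finally show ?thesis .
qed

section \<open>Counts of the Poisson process\<close>

context poisson_point_process
begin

text \<open>Measurability is contained in \<open>distributed\<close>, hence in the Poisson axiom of
  the locale.\<close>

lemma num_points_measurable [measurable]:
  assumes "B \<in> sets borel" "bounded B"
  shows "num_points \<Phi> B \<in> measurable M (count_space UNIV)"
  using poisson_num_points[OF assms] unfolding poisson_distributed_def
  by (rule distributed_measurable)

lemma prob_num_points:
  assumes "B \<in> sets borel" "bounded B" "\<mu> \<ge> 0"
  shows "prob {\<omega> \<in> space M. num_points \<Phi> B \<omega> = k}
       = (\<mu> * measure lborel B) ^ k / fact k * exp (- (\<mu> * measure lborel B))"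
proof -
  have "emeasure M (num_points \<Phi> B -` {k} \<inter> space M)
      = ennreal ((\<mu> * measure lborel B) ^ k / fact k * exp (- (\<mu> * measure lborel B)))"
    using distributed_emeasure[OF poisson_num_points[OF assms(1,2), unfolded poisson_distributed_def], of "{k}"]
    by (simp add: nn_integral_count_space_indicator[symmetric])
  \<comment> \<open>With \<open>\<mu> \<ge> 0\<close> the mass is nonnegative, so
    \<open>ennreal\<close> does not truncate it to 0.\<close>
  thus ?thesis
    using assms(3) by (simp add: measure_def vimage_def Int_def conj_commute)
qed

lemma num_points_indep:
  assumes "A \<in> sets borel" "bounded A" "C \<in> sets borel" "bounded C" "A \<inter> C = {}"
  shows "prob {\<omega> \<in> space M. num_points \<Phi> A \<omega> = k \<and> num_points \<Phi> C \<omega> = l}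
       = prob {\<omega> \<in> space M. num_points \<Phi> A \<omega> = k} * prob {\<omega> \<in> space M. num_points \<Phi> C \<omega> = l}"
proof -
  \<comment> \<open>The locale states independence for families indexed by \<open>{1..k}\<close>;
    \<open>D\<close> presents \<open>A\<close> and \<open>C\<close> as such a family with two
    members.\<close>
  define D where "D i = (if i = (1::nat) then A else C)" for i
  have "indep_vars (\<lambda>_. count_space UNIV) (\<lambda>i. num_points \<Phi> (D i)) {1..2}"
    using assms by (intro indep_num_points) (auto simp: D_def disjoint_family_on_def)
  hence "prob (\<Inter>i\<in>{1..2}. num_points \<Phi> (D i) -` {if i = 1 then k else l} \<inter> space M)
       = (\<Prod>i\<in>{1..2}. prob (num_points \<Phi> (D i) -` {if i = 1 then k else l} \<inter> space M))"
    by (rule indep_varsD) auto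
  moreover have "{1..2::nat} = {1, 2}" by auto
  moreover have "(num_points \<Phi> A -` {k} \<inter> space M) \<inter> (num_points \<Phi> C -` {l} \<inter> space M)
      = {\<omega> \<in> space M. num_points \<Phi> A \<omega> = k \<and> num_points \<Phi> C \<omega> = l}" by auto
  ultimately show ?thesis
    by (simp add: D_def vimage_def Int_def conj_commute)
qed

text \<open>The joint event means \<open>k\<close> points in \<open>A\<close> and
  \<open>n - k\<close> in \<open>B - A\<close>, two independent Poisson counts. Divided by the
  Poisson mass of \<open>B\<close> at \<open>n\<close>, the exponentials and the powers of
  \<open>\<mu>\<close> cancel and the factorials form the binomial coefficient.\<close>

lemma cond_prob_num_points:
  assumes \<mu>: "\<mu> > 0" and B: "B \<in> sets borel" "bounded B" "emeasure lborel B > 0"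
    and A: "A \<in> sets borel" "A \<subseteq> B" and k: "k \<le> n"
  defines "p \<equiv> measure lborel A / measure lborel B"
  shows "\<P>(\<omega> in M. num_points \<Phi> A \<omega> = k \<bar> num_points \<Phi> B \<omega> = n)
       = real (n choose k) * p ^ k * (1 - p) ^ (n - k)"
proof -
  define C where "C = B - A"
  have bdd: "bounded A" "bounded C" and C: "C \<in> sets borel"
    using A B unfolding C_def by (auto intro: bounded_subset)
  note [measurable] = num_points_measurable[OF A(1) bdd(1)] num_points_measurable[OF C bdd(2)]
    num_points_measurable[OF B(1,2)]
  have fin: "emeasure lborel B < \<infinity>" "emeasure lborel A < \<infinity>"
    using emeasure_bounded_finite B(2) bdd(1) by auto
  define a b where "a = measure lborel A" and "b = measure lborel B"
  have b: "b > 0" using B(3) fin unfolding b_def by (simp add: measure_def enn2real_positive_iff)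
  have c: "measure lborel C = b - a"
    unfolding C_def a_def b_def using fin A B by (intro measure_Diff) auto
  \<comment> \<open>This is claimed almost everywhere: \<open>card\<close> adds up over
    \<open>A\<close> and \<open>C\<close> where \<open>B\<close> holds finitely many points, but it
    is 0 on infinite sets.\<close>
  have "AE \<omega> in M. num_points \<Phi> A \<omega> = k \<and> num_points \<Phi> B \<omega> = n
          \<longleftrightarrow> num_points \<Phi> A \<omega> = k \<and> num_points \<Phi> C \<omega> = n - k"
    using locally_finite[OF B(1,2)]
  proof eventually_elim
    case (elim \<omega>)
    have "\<Phi> \<omega> \<inter> B = (\<Phi> \<omega> \<inter> A) \<union> (\<Phi> \<omega> \<inter> C)" using A(2) by (auto simp: C_def)
    moreover from this elim have "finite (\<Phi> \<omega> \<inter> A)" "finite (\<Phi> \<omega> \<inter> C)" by auto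
    moreover have "(\<Phi> \<omega> \<inter> A) \<inter> (\<Phi> \<omega> \<inter> C) = {}" by (auto simp: C_def)
    ultimately have "num_points \<Phi> B \<omega> = num_points \<Phi> A \<omega> + num_points \<Phi> C \<omega>"
      unfolding num_points_def by (simp add: card_Un_disjoint)
    \<comment> \<open>By \<open>k \<le> n\<close> the truncated subtraction \<open>n - k\<close> is
      the true difference.\<close>
    then show ?case using k by auto
  qed
  hence "prob {\<omega> \<in> space M. num_points \<Phi> A \<omega> = k \<and> num_points \<Phi> B \<omega> = n}
      = prob {\<omega> \<in> space M. num_points \<Phi> A \<omega> = k \<and> num_points \<Phi> C \<omega> = n - k}"
    by (intro finite_measure_eq_AE) auto
  also have "\<dots> = ((\<mu> * a) ^ k / fact k * exp (- (\<mu> * a)))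
      * ((\<mu> * (b - a)) ^ (n - k) / fact (n - k) * exp (- (\<mu> * (b - a))))"
    using num_points_indep[OF A(1) bdd(1) C bdd(2)] \<mu> c
    by (simp add: C_def prob_num_points[OF A(1) bdd(1)] prob_num_points[OF C bdd(2), unfolded C_def] a_def)
  also have "\<dots> = \<mu> ^ n * a ^ k * (b - a) ^ (n - k) / (fact k * fact (n - k)) * exp (- (\<mu> * b))"
  proof -
    have "exp (- (\<mu> * a)) * exp (- (\<mu> * (b - a))) = exp (- (\<mu> * b))"
      by (simp add: exp_add[symmetric] algebra_simps)
    moreover have "\<mu> ^ k * \<mu> ^ (n - k) = \<mu> ^ n" using k by (simp add: power_add[symmetric])
    ultimately show ?thesis by (simp add: power_mult_distrib) (metis (no_types) mult.assoc mult.commute)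
  qed
  finally have "\<P>(\<omega> in M. num_points \<Phi> A \<omega> = k \<bar> num_points \<Phi> B \<omega> = n)
      = \<mu> ^ n * a ^ k * (b - a) ^ (n - k) / (fact k * fact (n - k)) * exp (- (\<mu> * b))
        / ((\<mu> * b) ^ n / fact n * exp (- (\<mu> * b)))"
    using \<mu> by (simp add: cond_prob_def prob_num_points[OF B(1,2)] b_def)
  also have "\<dots> = (fact n / (fact k * fact (n - k))) * (a ^ k * (b - a) ^ (n - k) / b ^ n)"
    using \<mu> b by (simp add: power_mult_distrib mult_ac)
  \<comment> \<open>The power \<open>b ^ n\<close> is split so that \<open>a / b = p\<close> and
    \<open>(b - a) / b = 1 - p\<close> can be formed.\<close>
  also have "\<dots> = real (n choose k) * (a ^ k * (b - a) ^ (n - k) / (b ^ k * b ^ (n - k)))"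
    using k by (simp add: binomial_fact power_add[symmetric])
  also have "\<dots> = real (n choose k) * p ^ k * (1 - p) ^ (n - k)"
    using b by (simp add: p_def a_def[symmetric] b_def[symmetric] power_divide diff_divide_distrib[symmetric]
        diff_divide_eq_iff)
  finally show ?thesis .
qed

end

section \<open>Comparison of the two laws\<close>

theorem theorem2:
  fixes M :: "'w measure" and M' :: "'v measure"
    and \<mu> :: real and \<Phi> :: "'w \<Rightarrow> (real ^ 'd) set"
    and B :: "(real ^ 'd) set" and n :: nat
    and U :: "nat \<Rightarrow> 'v \<Rightarrow> real ^ 'd" and P :: "nat \<Rightarrow> 'w \<Rightarrow> real ^ 'd"
  assumes "\<mu> > 0"
    and "poisson_point_process M \<mu> \<Phi>"
    and "B \<in> sets borel" and "bounded B" and "emeasure lborel B > 0"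
    and "prob_space M'"
    and "prob_space.indep_vars M' (\<lambda>_. borel) U {1..n}"
    and "\<And>i. i \<in> {1..n} \<Longrightarrow> uniform_on M' (U i) B"
    and "\<And>\<omega>. \<omega> \<in> space M \<Longrightarrow> num_points \<Phi> B \<omega> = n \<Longrightarrow> finite (\<Phi> \<omega> \<inter> B) \<Longrightarrow>
           bij_betw (\<lambda>i. P i \<omega>) {1..n} (\<Phi> \<omega> \<inter> B)"
  shows "\<forall>A \<in> sets borel. A \<subseteq> B \<longrightarrow> (\<forall>k \<in> {0..n}.
           \<P>(\<omega> in M'. card (A \<inter> {U i \<omega> | i. i \<in> {1..n}}) = k)
         = \<P>(\<omega> in M. card (A \<inter> {P i \<omega> | i. i \<in> {1..n}}) = k \<bar> num_points \<Phi> B \<omega> = n))"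
proof (intro ballI impI)
  fix A k assume A: "A \<in> sets borel" "A \<subseteq> B" and k: "k \<in> {0..n}"
  interpret poisson_point_process M \<mu> \<Phi> by fact
  interpret M': prob_space M' by fact
  note B = assms(3-5)
  let ?p = "measure lborel A / measure lborel B"
  have "\<P>(\<omega> in M'. card (A \<inter> {U i \<omega> | i. i \<in> {1..n}}) = k)
      = real (n choose k) * ?p ^ k * (1 - ?p) ^ (n - k)"
    using M'.prob_card_uniform[OF assms(7,8) B A] by (simp add: image_def Bex_def conj_commute)
  also have "\<dots> = \<P>(\<omega> in M. card (A \<inter> {P i \<omega> | i. i \<in> {1..n}}) = k \<bar> num_points \<Phi> B \<omega> = n)"
  proof (cases "n = 0")
    case True
    \<comment> \<open>Separate, since \<open>num_points\<close> is also 0 where there are infinitely many points.\<close>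
    have "prob {\<omega> \<in> space M. num_points \<Phi> B \<omega> = 0} > 0"
      using prob_num_points[OF B(1,2), of 0] assms(1) by simp
    \<comment> \<open>Here \<open>k = 0\<close> and both index sets are empty, so the conditional
      probability is the mass of the conditioning event over itself; positivity excludes the default
      value 0 of \<open>0 / 0\<close>.\<close>
    then show ?thesis using k True by (simp add: cond_prob_def)
  next
    case False
    have "card (A \<inter> {P i \<omega> | i. i \<in> {1..n}}) = num_points \<Phi> A \<omega>"
      if "\<omega> \<in> space M" "num_points \<Phi> B \<omega> = n" for \<omega>
    proof -
      \<comment> \<open>A nonzero \<open>card\<close> forces finiteness, so the enumeration by
        \<open>P\<close> is available at every such \<open>\<omega>\<close>.\<close>
      have "finite (\<Phi> \<omega> \<inter> B)"
        using that(2) False unfolding num_points_def by (metis card.infinite)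
      from assms(9)[OF that this] have "{P i \<omega> | i. i \<in> {1..n}} = \<Phi> \<omega> \<inter> B"
        unfolding bij_betw_def by (simp add: image_def Bex_def conj_commute)
      moreover have "A \<inter> (\<Phi> \<omega> \<inter> B) = \<Phi> \<omega> \<inter> A" using A(2) by auto
      ultimately show ?thesis by (simp add: num_points_def)
    qed
    hence "{\<omega> \<in> space M. card (A \<inter> {P i \<omega> | i. i \<in> {1..n}}) = k \<and> num_points \<Phi> B \<omega> = n}
        = {\<omega> \<in> space M. num_points \<Phi> A \<omega> = k \<and> num_points \<Phi> B \<omega> = n}" by auto
    then show ?thesis
      using cond_prob_num_points[OF assms(1) B A, of k n] k by (simp add: cond_prob_def)
  qed
  finally show "\<P>(\<omega> in M'. card (A \<inter> {U i \<omega> | i. i \<in> {1..n}}) = k)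
      = \<P>(\<omega> in M. card (A \<inter> {P i \<omega> | i. i \<in> {1..n}}) = k \<bar> num_points \<Phi> B \<omega> = n)" .
qed

end
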